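(* If $G$ is an almost bipartite non-König-Egerváry graph with the unique odd cycle $C$, then $V(C)\cap N_G[\mathrm{diadem}(G)]=\emptyset$ or, equivalently, $N_G[V(C)]\cap \mathrm{diadem}(G)=\emptyset$.
   Context: All graphs are finite, undirected, loopless, without multiple edges; $n(G)=|V(G)|$. For $A\subseteq V(G)$, $N_G(A)=\{v\in V(G): v \text{ has a neighbor in } A\}$ and $N_G[A]=A\cup N_G(A)$. $\alpha(G)$ is the maximum size of an independent set and $\mu(G)$ the maximum size of a matching. $G$ is a König-Egerváry graph if $\alpha(G)+\mu(G)=n(G)$. $G$ is almost bipartite if it has exactly one odd cycle. For $X\subseteq V(G)$, $d(X)=|X|-|N_G(X)|$; the critical difference is $d(G)=\max\{d(I): I \text{ independent in } G\}$; an independent set $A$ (possibly empty) is a critical independent set if $d(A)=d(G)$. $\mathrm{diadem}(G)$ is the union of all critical independent sets of $G$. *)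

theory Defs
  imports "Graph_Theory.Digraph_Component"
begin

text \<open>
  Finite simple undirected graphs are the models of the locale \<^locale>\<open>graph\<close>: finite, loop-free
  symmetric digraphs without parallel arcs. An undirected edge \<open>uv\<close> is thus represented by the two
  arcs \<open>u \<rightarrow> v\<close> and \<open>v \<rightarrow> u\<close>, and is identified below with the set of its two end points.
\<close>

definition edge_of :: "('a,'b) pre_digraph \<Rightarrow> 'b \<Rightarrow> 'a set" where
  "edge_of G e = {tail G e, head G e}"

definition edges :: "('a,'b) pre_digraph \<Rightarrow> 'a set set" where
  "edges G = edge_of G ` arcs G"

definition nbhd :: "('a,'b) pre_digraph \<Rightarrow> 'a set \<Rightarrow> 'a set" where
  "nbhd G A = {v \<in> verts G. \<exists>u\<in>A. v \<rightarrow>\<^bsub>G\<^esub> u}"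

definition closed_nbhd :: "('a,'b) pre_digraph \<Rightarrow> 'a set \<Rightarrow> 'a set" where
  "closed_nbhd G A = A \<union> nbhd G A"

definition indep_set :: "('a,'b) pre_digraph \<Rightarrow> 'a set \<Rightarrow> bool" where
  "indep_set G S \<longleftrightarrow> S \<subseteq> verts G \<and> (\<forall>u\<in>S. \<forall>v\<in>S. \<not> u \<rightarrow>\<^bsub>G\<^esub> v)"

definition matching :: "('a,'b) pre_digraph \<Rightarrow> 'a set set \<Rightarrow> bool" where
  "matching G M \<longleftrightarrow> M \<subseteq> edges G \<and> (\<forall>e\<in>M. \<forall>f\<in>M. e \<noteq> f \<longrightarrow> e \<inter> f = {})"

text \<open>
  The maxima below are meant for finite graphs, where they range over finite sets of numbers that
  are nonempty because the empty set is both an independent set and a matching.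
\<close>

definition independence_number :: "('a,'b) pre_digraph \<Rightarrow> nat" where
  "independence_number G = Max {card S | S. indep_set G S}"

definition matching_number :: "('a,'b) pre_digraph \<Rightarrow> nat" where
  "matching_number G = Max {card M | M. matching G M}"

definition koenig_egervary :: "('a,'b) pre_digraph \<Rightarrow> bool" where
  "koenig_egervary G \<longleftrightarrow> independence_number G + matching_number G = card (verts G)"

text \<open>
  An odd cycle is a subgraph, not a closed walk: all rotations and both orientations of a cyclic
  arc walk \<open>p\<close> give the same \<open>C\<close>. For every edge of the cycle, \<open>C\<close> contains both arcs of \<open>G\<close>
  representing it. The bound on the length excludes the walks \<open>u \<rightarrow> v \<rightarrow> u\<close>, which are cycles in
  the sense of \<^const>\<open>pre_digraph.cycle\<close>, and loops.
\<close>

definition cycle_subgraph ::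
    "('a,'b) pre_digraph \<Rightarrow> 'b awalk \<Rightarrow> ('a,'b) pre_digraph \<Rightarrow> bool" where
  "cycle_subgraph G p C \<longleftrightarrow>
     pre_digraph.cycle G p \<and> 3 \<le> length p \<and> subgraph C G \<and>
     verts C = tail G ` set p \<and>
     arcs C = {e \<in> arcs G. edge_of G e \<in> edge_of G ` set p}"

definition odd_cycle :: "('a,'b) pre_digraph \<Rightarrow> ('a,'b) pre_digraph \<Rightarrow> bool" where
  "odd_cycle G C \<longleftrightarrow> (\<exists>p. cycle_subgraph G p C \<and> odd (length p))"

definition almost_bipartite :: "('a,'b) pre_digraph \<Rightarrow> bool" where
  "almost_bipartite G \<longleftrightarrow> (\<exists>!C. odd_cycle G C)"

definition difference :: "('a,'b) pre_digraph \<Rightarrow> 'a set \<Rightarrow> int" where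
  "difference G X = int (card X) - int (card (nbhd G X))"

definition critical_difference :: "('a,'b) pre_digraph \<Rightarrow> int" where
  "critical_difference G = Max {difference G I | I. indep_set G I}"

definition critical_indep_set :: "('a,'b) pre_digraph \<Rightarrow> 'a set \<Rightarrow> bool" where
  "critical_indep_set G A \<longleftrightarrow> indep_set G A \<and> difference G A = critical_difference G"

definition diadem :: "('a,'b) pre_digraph \<Rightarrow> 'a set" where
  "diadem G = \<Union>{A. critical_indep_set G A}"

end

theory Submission
  imports Defs
begin

text \<open>
  It suffices to find, for every critical independent set \<open>A\<close> of a graph that is not
  Koenig-Egervary, an odd cycle disjoint from \<open>N[A]\<close> (\<open>odd_cycle_avoiding_critical_set\<close>): if the odd
  cycle \<open>C\<close> is unique, then \<open>C\<close> avoids \<open>N[A]\<close> for every \<open>A\<close>, hence also \<open>N[diadem(G)]\<close>; the second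
  form of the claim follows because adjacency is symmetric. So assume that the subgraph induced by the set \<open>W\<close> of vertices outside
  \<open>N[A]\<close> has no odd cycle. Then it is bipartite (\<open>two_colouring_of_no_odd_cycle\<close>), and the claim is that
  this makes the whole graph Koenig-Egervary (\<open>koenig_egervary_of_bipartite_remainder\<close>).

  Keep only the edges between \<open>A\<close> and \<open>N(A)\<close> and the edges inside \<open>W\<close>. They form a bipartite graph,
  which by Koenig's theorem (\<open>bipartite_koenig\<close>) has a matching \<open>M\<close> and a vertex cover \<open>S\<close> with \<open>|S| \<le> |M|\<close>.
  The set \<open>A \<union> (W - S)\<close> is independent in the whole graph, since \<open>A\<close> has neighbours in \<open>N(A)\<close> only.
  Criticality of \<open>A\<close>, compared with the independent set \<open>A - S\<close>, whose neighbours all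
  lie in \<open>N(A) \<inter> S\<close>, gives \<open>|A - S| + |N(A) - S| \<le> |A|\<close>. Hence the complement of \<open>S\<close> has at most
  \<open>|A \<union> (W - S)|\<close> elements, and this independent set together with \<open>M\<close> reaches the number of
  vertices.
\<close>

section \<open>Koenig's theorem for bipartite edge sets\<close>

text \<open>
  Induction on the number of edges, without alternating paths. Two edges \<open>e = vx\<close> and \<open>f = vy\<close> that
  share a vertex are deleted in turn; let \<open>M\<close> be the larger of the two matchings. The
  covers \<open>S\<^sub>e\<close> and \<open>S\<^sub>f\<close> have at most \<open>|M|\<close> vertices, and each of them misses at most one edge. If one
  contains \<open>v\<close>, it covers everything. Otherwise they are combined by taking the intersection on one
  side of the bipartition and the union on the other. Both combinations cover all edges other than
  \<open>e\<close> and \<open>f\<close>, and their sizes add up to at most \<open>2|M|\<close>. The one with the union on the side of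
  \<open>x\<close> and \<open>y\<close> covers \<open>e\<close> and \<open>f\<close> as well; if it has more than \<open>|M|\<close> vertices, then the other one has
  fewer than \<open>|M|\<close>, which leaves room for \<open>v\<close>.
\<close>
lemma bipartite_koenig:
  fixes E :: "'a set set"
  assumes "finite E"
    and "\<And>e. e \<in> E \<Longrightarrow> \<exists>p\<in>P. \<exists>q\<in>Q. e = {p, q}"
    and "P \<inter> Q = {}"
  shows "\<exists>M S. M \<subseteq> E \<and> pairwise disjnt M \<and> S \<subseteq> \<Union>E \<and> (\<forall>e\<in>E. e \<inter> S \<noteq> {}) \<and> card S \<le> card M"
  using assms(1,2)
proof (induction "card E" arbitrary: E rule: less_induct)
  case less
  note fin = less.prems(1) and bip = less.prems(2)
  have finU: "finite (\<Union>E)" using fin bip by fastforce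
  show ?case
  proof (cases "pairwise disjnt E")
    case True
    define pick where "pick = (\<lambda>e::'a set. SOME x. x \<in> e)"
    have pick: "pick e \<in> e" if "e \<in> E" for e
      unfolding pick_def using bip[OF that] by (metis insertI1 someI)
    have "card (pick ` E) \<le> card E" by (rule card_image_le[OF fin])
    moreover have "\<forall>e\<in>E. e \<inter> pick ` E \<noteq> {}" using pick by blast
    moreover have "pick ` E \<subseteq> \<Union>E" using pick by blast
    ultimately show ?thesis using True by blast
  next
    case False
    then obtain e f v where e: "e \<in> E" and f: "f \<in> E" and "e \<noteq> f" and v: "v \<in> e" "v \<in> f"
      by (auto simp: pairwise_def disjnt_iff)
    \<comment> \<open>Rename the two sides so that the shared vertex lies in the first one.\<close>
    obtain X Y where bipXY: "\<And>e. e \<in> E \<Longrightarrow> \<exists>p\<in>X. \<exists>q\<in>Y. e = {p, q}" and XY: "X \<inter> Y = {}"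
      and vX: "v \<in> X"
    proof (cases "v \<in> P")
      case True
      then show ?thesis using that bip assms(3) by blast
    next
      case False
      then have "v \<in> Q" using bip[OF e] v by blast
      then show ?thesis using that[of Q P] bip assms(3) by (metis Int_commute doubleton_eq_iff)
    qed
    obtain x where x: "x \<in> Y" "e = {v, x}" using bipXY[OF e] v XY vX by blast
    obtain y where y: "y \<in> Y" "f = {v, y}" using bipXY[OF f] v XY vX by blast
    have UXY: "\<Union>E \<subseteq> X \<union> Y" using bipXY by fastforce
    have IH: "\<exists>M S. M \<subseteq> E \<and> pairwise disjnt M \<and> S \<subseteq> \<Union>E
        \<and> (\<forall>h\<in>E - {g}. h \<inter> S \<noteq> {}) \<and> card S \<le> card M" if "g \<in> E" for g
    proof -
      have "\<exists>M S. M \<subseteq> E - {g} \<and> pairwise disjnt M \<and> S \<subseteq> \<Union>(E - {g})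
          \<and> (\<forall>h\<in>E - {g}. h \<inter> S \<noteq> {}) \<and> card S \<le> card M"
      proof (rule less.hyps)
        show "card (E - {g}) < card E" by (rule card_Diff1_less[OF fin that])
        show "finite (E - {g})" using fin by simp
        show "\<exists>p\<in>P. \<exists>q\<in>Q. e = {p, q}" if "e \<in> E - {g}" for e using bip that by blast
      qed
      moreover have "M \<subseteq> E" "S \<subseteq> \<Union>E" if "M \<subseteq> E - {g}" "S \<subseteq> \<Union>(E - {g})" for M S
        using that by auto
      ultimately show ?thesis by meson
    qed
    obtain Me Se where Me: "Me \<subseteq> E" "pairwise disjnt Me" and Se: "Se \<subseteq> \<Union>E"
      "\<forall>g\<in>E - {e}. g \<inter> Se \<noteq> {}" and cSe: "card Se \<le> card Me"
      using IH[OF e] by (elim exE conjE) (rule that)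
    obtain Mf Sf where Mf: "Mf \<subseteq> E" "pairwise disjnt Mf" and Sf: "Sf \<subseteq> \<Union>E"
      "\<forall>g\<in>E - {f}. g \<inter> Sf \<noteq> {}" and cSf: "card Sf \<le> card Mf"
      using IH[OF f] by (elim exE conjE) (rule that)
    obtain M where M: "M \<subseteq> E" "pairwise disjnt M" and "card Me \<le> card M" "card Mf \<le> card M"
      using Me Mf by (metis nle_le)
    with cSe cSf have cards: "card Se \<le> card M" "card Sf \<le> card M" by auto
    have solved: ?thesis if "S \<subseteq> \<Union>E" "\<forall>g\<in>E. g \<inter> S \<noteq> {}" "card S \<le> card M" for S
      using that M by (intro exI[of _ M] exI[of _ S] conjI)
    have finS: "finite Se" "finite Sf"
      using finite_subset[OF Se(1) finU] finite_subset[OF Sf(1) finU] by simp_all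
    have SXY: "Se \<subseteq> X \<union> Y" "Sf \<subseteq> X \<union> Y"
      using order.trans[OF Se(1) UXY] order.trans[OF Sf(1) UXY] by simp_all
    define T where "T = (Se \<inter> Sf \<inter> X) \<union> ((Se \<union> Sf) \<inter> Y)"
    define T' where "T' = (Se \<inter> Sf \<inter> Y) \<union> ((Se \<union> Sf) \<inter> X)"
    have "card T = card (Se \<inter> Sf \<inter> X) + card ((Se \<union> Sf) \<inter> Y)"
      unfolding T_def using XY finS by (intro card_Un_disjoint) auto
    moreover have "card T' = card (Se \<inter> Sf \<inter> Y) + card ((Se \<union> Sf) \<inter> X)"
      unfolding T'_def using XY finS by (intro card_Un_disjoint) auto
    moreover have "card Z = card (Z \<inter> X) + card (Z \<inter> Y)" if "finite Z" "Z \<subseteq> X \<union> Y" for Z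
    proof -
      have "Z = (Z \<inter> X) \<union> (Z \<inter> Y)" using that by blast
      moreover have "card ((Z \<inter> X) \<union> (Z \<inter> Y)) = card (Z \<inter> X) + card (Z \<inter> Y)"
        using that XY by (intro card_Un_disjoint) auto
      ultimately show ?thesis by simp
    qed
    note this[of "Se \<inter> Sf"] this[of "Se \<union> Sf"]
    ultimately have "card T + card T' = card (Se \<inter> Sf) + card (Se \<union> Sf)"
      using finS SXY by (simp add: le_infI1)
    also have "card (Se \<inter> Sf) + card (Se \<union> Sf) = card Se + card Sf"
      using card_Un_Int[OF finS] by simp
    finally have sumT: "card T + card T' \<le> 2 * card M" using cards by simp
    have cov: "g \<inter> T \<noteq> {} \<and> g \<inter> T' \<noteq> {}" if g: "g \<in> E" "g \<noteq> e" "g \<noteq> f" for g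
    proof -
      obtain p q where "p \<in> X" "q \<in> Y" "g = {p, q}" using bipXY[OF g(1)] by blast
      moreover have "g \<inter> Se \<noteq> {}" "g \<inter> Sf \<noteq> {}" using Se Sf g by auto
      ultimately show ?thesis unfolding T_def T'_def by blast
    qed
    consider "v \<in> Se" | "v \<in> Sf" | "v \<notin> Se" "v \<notin> Sf" by blast
    then show ?thesis
    proof cases
      case 1
      then have "\<forall>g\<in>E. g \<inter> Se \<noteq> {}" using Se(2) v by blast
      then show ?thesis by (rule solved[OF Se(1) _ cards(1)])
    next
      case 2
      then have "\<forall>g\<in>E. g \<inter> Sf \<noteq> {}" using Sf(2) v by blast
      then show ?thesis by (rule solved[OF Sf(1) _ cards(2)])
    next
      case 3
      have "f \<inter> Se \<noteq> {}" "e \<inter> Sf \<noteq> {}" using Se(2) Sf(2) e f \<open>e \<noteq> f\<close> by auto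
      then have "y \<in> Se" "x \<in> Sf" using x(2) y(2) 3 by auto
      then have "x \<in> T" "y \<in> T" using x y by (auto simp: T_def)
      then have "e \<inter> T \<noteq> {}" "f \<inter> T \<noteq> {}" using x(2) y(2) by auto
      then have covT: "\<forall>g\<in>E. g \<inter> T \<noteq> {}" using cov by metis
      have covT': "\<forall>g\<in>E. g \<inter> insert v T' \<noteq> {}"
      proof
        fix g assume "g \<in> E"
        then show "g \<inter> insert v T' \<noteq> {}" using cov[of g] v by (cases "g = e \<or> g = f") auto
      qed
      have "T \<subseteq> Se \<union> Sf" "T' \<subseteq> Se \<union> Sf" by (auto simp: T_def T'_def)
      then have "T \<subseteq> \<Union>E" "insert v T' \<subseteq> \<Union>E" using Se(1) Sf(1) v(1) e by blast+
      moreover have "card T \<le> card M \<or> card (insert v T') \<le> card M"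
      proof -
        have "card (insert v T') \<le> Suc (card T')" by (rule card_insert_le_m1) simp_all
        then show ?thesis using sumT by linarith
      qed
      ultimately show ?thesis using solved[OF _ covT] solved[OF _ covT'] by argo
    qed
  qed
qed

section \<open>Graphs without odd cycles are two-colourable\<close>

context graph
begin

lemma dominates_sym: "u \<rightarrow>\<^bsub>G\<^esub> v \<Longrightarrow> v \<rightarrow>\<^bsub>G\<^esub> u"
  by (rule arcs_ends_symmetric[OF sym_arcs])

text \<open>
  At a repeated vertex a closed walk splits into two shorter closed walks, and one of them is odd.
\<close>
lemma odd_closed_walk_contains_odd_cycle:
  assumes "awalk u p u" "odd (length p)"
  shows "\<exists>q. cycle q \<and> odd (length q)"
  using assms
proof (induction "length p" arbitrary: u p rule: less_induct)
  case less
  note walk = less.prems(1) and odd = less.prems(2)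
  show ?case
  proof (cases "distinct (tl (awalk_verts u p))")
    case True
    then show ?thesis using less.prems unfolding cycle_def by fastforce
  next
    case False
    then obtain e es where p: "p = e # es" by (cases p) auto
    with False walk have es: "awalk (head G e) es u" "\<not> distinct (awalk_verts (head G e) es)"
      by (auto simp: awalk_Cons_iff)
    obtain q r s w where qrs: "es = q @ r @ s" "awalk (head G e) q w" "awalk w r w" "awalk w s u" "r \<noteq> []"
      using awalk_not_distinct_decomp[OF es] by auto
    show ?thesis
    proof (cases "odd (length r)")
      case True
      then show ?thesis using less.hyps[of r w] qrs p by auto
    next
      case False
      have "awalk u (e # q @ s) u"
        using walk qrs p by (auto simp: awalk_Cons_iff)
      moreover have "length (e # q @ s) < length p" using qrs p by auto
      moreover have "odd (length (e # q @ s))" using odd False qrs p by auto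
      ultimately show ?thesis using less.hyps by blast
    qed
  qed
qed

lemma walk_reversal:
  assumes "awalk u p v"
  shows "\<exists>q. awalk v q u \<and> length q = length p"
  using assms
proof (induction p arbitrary: u)
  case Nil
  then show ?case by (intro exI[of _ "[]"]) (auto simp: awalk_Nil_iff)
next
  case (Cons e es)
  then obtain q where q: "awalk v q (head G e)" "length q = length es"
    by (auto simp: awalk_Cons_iff)
  have e: "e \<in> arcs G" "tail G e = u" using Cons.prems by (auto simp: awalk_Cons_iff)
  obtain e' where "e' \<in> arcs G" "tail G e = head G e'" "head G e = tail G e'"
    using sym_arcs e(1) unfolding symmetric_conv by blast
  then have "awalk v (q @ [e']) u" using q e by (auto simp: awalk_Cons_iff awalk_Nil_iff)
  then show ?case using q(2) by (intro exI[of _ "q @ [e']"]) auto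
qed

lemma two_colouring_of_no_odd_cycle:
  assumes "\<And>p. cycle p \<Longrightarrow> even (length p)"
  obtains c where "\<And>u v. u \<rightarrow>\<^bsub>G\<^esub> v \<Longrightarrow> c u \<noteq> (c v :: bool)"
proof -
  \<comment> \<open>A vertex is coloured by the parity of a walk from a representative of its component. The
    representative is chosen from the set of vertices that reach \<open>v\<close>, which is the same set for all
    vertices of the component.\<close>
  define r where "r = (\<lambda>v. SOME u. u \<rightarrow>\<^sup>* v)"
  define c where "c = (\<lambda>v. \<exists>p. awalk (r v) p v \<and> even (length p))"
  have "c u \<noteq> c v" if uv: "u \<rightarrow>\<^bsub>G\<^esub> v" for u v
  proof
    assume same: "c u = c v"
    have vu: "v \<rightarrow>\<^bsub>G\<^esub> u" by (rule dominates_sym[OF uv])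
    have "(\<lambda>w. w \<rightarrow>\<^sup>* u) = (\<lambda>w. w \<rightarrow>\<^sup>* v)"
      using reachable_adj_trans uv vu by blast
    then have r: "r u = r v" by (simp add: r_def)
    have "u \<rightarrow>\<^sup>* u" "v \<rightarrow>\<^sup>* v" using uv adj_in_verts by auto
    then have "r u \<rightarrow>\<^sup>* u" "r v \<rightarrow>\<^sup>* v"
      unfolding r_def by - (erule someI)+
    then obtain p q where pq: "awalk (r u) p u" "awalk (r v) q v"
      by (auto simp: reachable_awalk)
    \<comment> \<open>For an equal colour, walks of equal parity lead to both ends of the edge, and with the edge
      they close up to an odd closed walk.\<close>
    have "\<exists>p q. awalk (r u) p u \<and> awalk (r u) q v \<and> even (length p + length q)"
    proof (cases "c u")
      case True
      with same show ?thesis unfolding c_def r by (metis even_add)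
    next
      case False
      with same have "odd (length p)" "odd (length q)" using pq by (auto simp: c_def)
      then show ?thesis using pq r by (metis even_add)
    qed
    then obtain p q where p: "awalk (r u) p u" and q: "awalk (r u) q v" and par: "even (length p + length q)"
      by blast
    obtain q' where q': "awalk v q' (r u)" "length q' = length q" using walk_reversal[OF q] by blast
    obtain e where e: "e \<in> arcs G" "tail G e = u" "head G e = v" using uv by auto
    have "awalk (r u) (p @ e # q') (r u)" using p q' e by (auto simp: awalk_Cons_iff)
    moreover have "odd (length (p @ e # q'))" using par q' by auto
    ultimately show False using odd_closed_walk_contains_odd_cycle assms by blast
  qed
  then show ?thesis by (rule that)
qed

text \<open>
  The lower bound 3 on the length holds because there are no loops and the back-and-forth
  walks of length 2 are even.
\<close>
lemma cycle_subgraph_of_odd_cycle_walk: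
  assumes cyc: "cycle p" and "odd (length p)"
  shows "\<exists>C. cycle_subgraph G p C"
proof -
  obtain u where walk: "awalk u p u" and ne: "p \<noteq> []" using cyc by (auto simp: cycle_def)
  have pa: "set p \<subseteq> arcs G" using walk by auto
  have "length p \<noteq> 1"
  proof
    assume "length p = 1"
    then obtain e where "p = [e]" by (cases p) auto
    then show False using walk no_loops[of e] by (auto simp: awalk_Cons_iff awalk_Nil_iff)
  qed
  then have len: "3 \<le> length p" using \<open>odd (length p)\<close> by (cases "length p = 2") presburger+
  \<comment> \<open>The walk is closed, so every vertex on it is the tail of one of its arcs.\<close>
  have "set (awalk_verts u p) \<subseteq> tail G ` set p"
  proof -
    have "head G (last p) = u" "tail G (hd p) = u"
      using walk ne awalk_verts_conv[of u p] awalkE[OF walk] by (auto simp: hd_append hd_map)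
    then have "head G (last p) \<in> tail G ` set p" using ne by (metis hd_in_set image_eqI)
    then show ?thesis using ne by (auto simp: awalk_verts_conv)
  qed
  then have heads: "head G e \<in> tail G ` set p" if "e \<in> set p" for e
    using awalk_verts_arc2[OF walk that] by blast
  define C where "C = \<lparr>verts = tail G ` set p,
      arcs = {e \<in> arcs G. edge_of G e \<in> edge_of G ` set p}, tail = tail G, head = head G\<rparr>"
  have ends: "edge_of G e \<subseteq> tail G ` set p" if "e \<in> arcs C" for e
  proof -
    have "edge_of G e \<in> edge_of G ` set p" using that by (simp add: C_def)
    then obtain f where f: "f \<in> set p" "edge_of G e = edge_of G f" by blast
    then show ?thesis using heads[OF f(1)] by (auto simp: edge_of_def)
  qed
  have "wf_digraph C"
    by unfold_locales (use ends in \<open>auto simp: C_def edge_of_def\<close>)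
  then have "subgraph C G"
    using pa wf_digraph by (auto simp: subgraph_def compatible_def C_def)
  then show ?thesis using cyc len by (auto simp: cycle_subgraph_def C_def)
qed

section \<open>A criterion for Koenig-Egervary graphs\<close>

text \<open>
  Each matching edge has an end outside the independent set, and these ends are distinct.
\<close>
lemma indep_matching_le:
  assumes "indep_set G I" "matching G M"
  shows "card I + card M \<le> card (verts G)"
proof -
  have I: "I \<subseteq> verts G" using assms by (simp add: indep_set_def)
  have "\<exists>x. x \<in> e \<and> x \<in> verts G - I" if "e \<in> M" for e
  proof -
    have "e \<in> edges G" using that assms by (auto simp: matching_def)
    then obtain a where a: "a \<in> arcs G" "e = {tail G a, head G a}"
      by (auto simp: edges_def edge_of_def)
    then have "\<not> (tail G a \<in> I \<and> head G a \<in> I)"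
      using assms(1) by (auto simp: indep_set_def dest: in_arcs_imp_in_arcs_ends)
    then show ?thesis using a by auto
  qed
  then obtain f where f: "\<And>e. e \<in> M \<Longrightarrow> f e \<in> e \<and> f e \<in> verts G - I" by metis
  have "inj_on f M"
    using f assms(2) unfolding inj_on_def matching_def by (metis disjoint_iff)
  then have "card M \<le> card (verts G - I)"
    using f by (intro card_inj_on_le) auto
  also have "\<dots> = card (verts G) - card I" using I by (simp add: card_Diff_subset finite_subset)
  finally show ?thesis using card_mono[OF finite_verts I] by linarith
qed

text \<open>
  By the preceding bound, a pair that attains it consists of a maximum independent set and a maximum
  matching; neither maximum has to be computed separately.
\<close>
lemma koenig_egervary_of_tight_pair:
  assumes I: "indep_set G I" and M: "matching G M" and ge: "card (verts G) \<le> card I + card M"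
  shows "koenig_egervary G"
proof -
  have *: "card J \<le> card I" if "indep_set G J" for J
    using indep_matching_le[OF that M] ge by simp
  have **: "card N \<le> card M" if "matching G N" for N
    using indep_matching_le[OF I that] ge by simp
  have "independence_number G = card I"
    unfolding independence_number_def
  proof (rule Max_eqI)
    have "{card J | J. indep_set G J} \<subseteq> {..card I}" using * by auto
    then show "finite {card J | J. indep_set G J}" by (rule finite_subset) simp
  qed (use * I in auto)
  moreover have "matching_number G = card M"
    unfolding matching_number_def
  proof (rule Max_eqI)
    have "{card N | N. matching G N} \<subseteq> {..card M}" using ** by auto
    then show "finite {card N | N. matching G N}" by (rule finite_subset) simp
  qed (use ** M in auto)
  ultimately show ?thesis
    using indep_matching_le[OF I M] ge by (simp add: koenig_egervary_def)
qed

section \<open>Critical independent sets\<close>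

lemma difference_le_critical:
  assumes "indep_set G I"
  shows "difference G I \<le> critical_difference G"
proof -
  have "{difference G I | I. indep_set G I} \<subseteq> difference G ` Pow (verts G)"
    by (auto simp: indep_set_def)
  then have "finite {difference G I | I. indep_set G I}"
    by (rule finite_subset) simp
  then show ?thesis unfolding critical_difference_def using assms by (intro Max_ge) auto
qed

text \<open>
  The edges left out of \<open>E\<close> all meet \<open>N(A)\<close> and are therefore harmless to the
  independent set \<open>A \<union> (W - S)\<close>. Criticality serves to replace \<open>A - S\<close> and \<open>N(A) - S\<close>
  by \<open>A\<close> in the complement of the cover without losing vertices.
\<close>
lemma koenig_egervary_of_bipartite_remainder:
  assumes crit: "critical_indep_set G A"
    and col: "\<And>u v. u \<rightarrow>\<^bsub>G\<^esub> v \<Longrightarrow> u \<notin> closed_nbhd G A \<Longrightarrow> v \<notin> closed_nbhd G A \<Longrightarrow> c u \<noteq> (c v :: bool)"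
  shows "koenig_egervary G"
proof -
  define B where "B = nbhd G A"
  define W where "W = verts G - closed_nbhd G A"
  define E where "E = {{u, v} | u v. u \<rightarrow>\<^bsub>G\<^esub> v \<and> (u \<in> A \<or> (u \<in> W \<and> v \<in> W))}"
  have indA: "indep_set G A" using crit by (simp add: critical_indep_set_def)
  have AV: "A \<subseteq> verts G" using indA by (simp add: indep_set_def)
  have BV: "B \<subseteq> verts G" by (auto simp: B_def nbhd_def)
  have nbr: "v \<in> B" if "u \<rightarrow>\<^bsub>G\<^esub> v" "u \<in> A" for u v
    using that dominates_sym adj_in_verts by (auto simp: B_def nbhd_def)
  have AB: "A \<inter> B = {}" using indA by (auto simp: indep_set_def B_def nbhd_def)
  have part: "verts G = A \<union> B \<union> W" "W \<inter> A = {}" "W \<inter> B = {}"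
    using AV BV by (auto simp: W_def closed_nbhd_def B_def)
  have finV: "finite A" "finite B" "finite W"
    using AV BV finite_subset[OF _ finite_verts] by (auto simp: W_def)
  have Eedges: "E \<subseteq> edges G"
    by (auto simp: E_def edges_def edge_of_def arcs_ends_conv)
  have finE: "finite E"
    by (rule finite_subset[OF Eedges]) (simp add: edges_def)
  have bip: "\<exists>p \<in> A \<union> {w\<in>W. c w}. \<exists>q \<in> B \<union> {w\<in>W. \<not> c w}. e = {p, q}" if "e \<in> E" for e
  proof -
    obtain u v where e: "e = {u, v}" and uv: "u \<rightarrow>\<^bsub>G\<^esub> v" and "u \<in> A \<or> (u \<in> W \<and> v \<in> W)"
      using \<open>e \<in> E\<close> by (auto simp: E_def)
    then consider "u \<in> A" | "u \<in> W" "v \<in> W" "c u \<noteq> c v"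
      using col[OF uv] by (auto simp: W_def)
    then show ?thesis
    proof cases
      case 1
      then show ?thesis using nbr[OF uv] e by (intro bexI[of _ u] bexI[of _ v]) auto
    next
      case 2
      show ?thesis
      proof (cases "c u")
        case True
        with 2 show ?thesis using e by (intro bexI[of _ u] bexI[of _ v]) auto
      next
        case False
        with 2 show ?thesis using e by (intro bexI[of _ v] bexI[of _ u]) auto
      qed
    qed
  qed
  have "(A \<union> {w\<in>W. c w}) \<inter> (B \<union> {w\<in>W. \<not> c w}) = {}" using AB part by auto
  from bipartite_koenig[OF finE bip this]
  obtain M S where M: "M \<subseteq> E" "pairwise disjnt M" and S: "\<forall>e\<in>E. e \<inter> S \<noteq> {}" and SE: "S \<subseteq> \<Union>E"
    and cS: "card S \<le> card M" by blast
  have SV: "S \<subseteq> verts G" using SE by (auto simp: E_def dest: adj_in_verts)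
  have finS: "finite S" by (rule finite_subset[OF SV finite_verts])
  have "matching G M"
    using M Eedges by (auto simp: matching_def pairwise_def disjnt_def)
  moreover have "indep_set G (A \<union> (W - S))"
  proof -
    have False if "u \<in> A \<union> (W - S)" "v \<in> A \<union> (W - S)" "u \<rightarrow>\<^bsub>G\<^esub> v" for u v
    proof -
      have "u \<notin> A" using that nbr[of u v] AB part by auto
      moreover have "v \<notin> A" using that nbr[of v u] dominates_sym AB part by auto
      ultimately have "{u, v} \<in> E" using that unfolding E_def by blast
      then have "{u, v} \<inter> S \<noteq> {}" using S by (rule bspec[rotated])
      then show False using that \<open>u \<notin> A\<close> \<open>v \<notin> A\<close> by auto
    qed
    moreover have "A \<union> (W - S) \<subseteq> verts G" using part by blast
    ultimately show ?thesis unfolding indep_set_def by blast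
  qed
  moreover have "card (verts G) \<le> card (A \<union> (W - S)) + card M"
  proof -
    have "nbhd G (A - S) \<subseteq> B \<inter> S"
    proof
      fix v assume "v \<in> nbhd G (A - S)"
      then obtain u where u: "u \<in> A" "u \<notin> S" "u \<rightarrow>\<^bsub>G\<^esub> v"
        using dominates_sym by (auto simp: nbhd_def)
      then have "{u, v} \<in> E" unfolding E_def by blast
      then have "{u, v} \<inter> S \<noteq> {}" using S by (rule bspec[rotated])
      then show "v \<in> B \<inter> S" using u nbr[of u v] by auto
    qed
    then have "card (nbhd G (A - S)) \<le> card (B \<inter> S)" using finV by (intro card_mono) auto
    moreover have "indep_set G (A - S)" using indA by (auto simp: indep_set_def)
    then have "difference G (A - S) \<le> difference G A"
      using difference_le_critical crit by (simp add: critical_indep_set_def)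
    moreover have "card B = card (B \<inter> S) + card (B - S)"
      using finV by (metis Int_Diff_Un Int_Diff_disjoint card_Un_disjoint finite_Diff finite_Int)
    ultimately have cover_count: "card (A - S) + card (B - S) \<le> card A"
      by (auto simp: difference_def B_def)
    have "card (A - S) + card (B - S) + card (W - S) \<ge> card ((A - S) \<union> (B - S) \<union> (W - S))"
      by (meson add_le_mono card_Un_le le_refl le_trans)
    moreover have "verts G - S = (A - S) \<union> (B - S) \<union> (W - S)" using part by blast
    moreover have "card (verts G) \<le> card S + card (verts G - S)"
      using finS SV by (simp add: card_Diff_subset)
    moreover have "card (A \<union> (W - S)) = card A + card (W - S)"
      using finV part by (intro card_Un_disjoint) auto
    ultimately show ?thesis using cover_count cS by simp
  qed
  ultimately show ?thesis by (intro koenig_egervary_of_tight_pair)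
qed

lemma odd_cycle_avoiding_critical_set:
  assumes "\<not> koenig_egervary G" and crit: "critical_indep_set G A"
  shows "\<exists>C. odd_cycle G C \<and> verts C \<inter> closed_nbhd G A = {}"
proof -
  define H where "H = G \<restriction> (verts G - closed_nbhd G A)"
  have ind: "induced_subgraph H G" unfolding H_def by (rule induced_induce) blast
  then have sub: "subgraph H G" by (rule induced_imp_subgraph)
  interpret H: graph H
    using digraph_subgraph[OF sub] induced_graph_imp_symmetric[OF sym_arcs ind] by (rule digraph.graphI)
  have "\<exists>p. H.cycle p \<and> odd (length p)"
  proof (rule ccontr)
    assume "\<not> ?thesis"
    then obtain c where c: "\<And>u v. u \<rightarrow>\<^bsub>H\<^esub> v \<Longrightarrow> c u \<noteq> (c v :: bool)"
      using H.two_colouring_of_no_odd_cycle by blast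
    have "c u \<noteq> c v" if "u \<rightarrow>\<^bsub>G\<^esub> v" "u \<notin> closed_nbhd G A" "v \<notin> closed_nbhd G A" for u v
    proof (rule c)
      show "u \<rightarrow>\<^bsub>H\<^esub> v" using that by (auto simp: H_def arcs_ends_conv)
    qed
    then show False using koenig_egervary_of_bipartite_remainder[OF crit] assms(1) by blast
  qed
  \<comment> \<open>The cycle subgraph is taken in \<open>G\<close>, where uniqueness of the odd cycle can be applied;
    only its vertices matter for avoiding \<open>N[A]\<close>.\<close>
  then obtain p where p: "H.cycle p" "odd (length p)" by blast
  obtain C where C: "cycle_subgraph G p C"
    using cycle_subgraph_of_odd_cycle_walk subgraph_cycle[OF sub p(1)] p(2) by blast
  have "set p \<subseteq> arcs H" using p(1) by (auto simp: H.cycle_def)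
  then have "tail G ` set p \<inter> closed_nbhd G A = {}" by (auto simp: H_def)
  moreover have "verts C = tail G ` set p" using C by (simp add: cycle_subgraph_def)
  moreover have "odd_cycle G C" using C p(2) unfolding odd_cycle_def by blast
  ultimately show ?thesis by (intro exI[of _ C]) simp
qed

end

theorem proposition2p9:
  fixes G C :: "('a,'b) pre_digraph"
  assumes "graph G"
    and "almost_bipartite G"
    and "\<not> koenig_egervary G"
    and "odd_cycle G C"
  shows "verts C \<inter> closed_nbhd G (diadem G) = {} \<and>
         closed_nbhd G (verts C) \<inter> diadem G = {}"
proof -
  interpret graph G by (rule assms)
  have unique: "C' = C" if "odd_cycle G C'" for C'
    using assms(2,4) that by (auto simp: almost_bipartite_def)
  have avoid: "verts C \<inter> closed_nbhd G A = {}" if "critical_indep_set G A" for A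
    using odd_cycle_avoiding_critical_set[OF assms(3) that] unique by auto
  have "closed_nbhd G (diadem G) = (\<Union>A \<in> {A. critical_indep_set G A}. closed_nbhd G A)"
    by (auto simp: closed_nbhd_def nbhd_def diadem_def)
  then have no_cycle_vertex: "verts C \<inter> closed_nbhd G (diadem G) = {}" using avoid by auto
  have CV: "verts C \<subseteq> verts G" using assms(4) by (auto simp: odd_cycle_def cycle_subgraph_def)
  have "closed_nbhd G (verts C) \<inter> diadem G = {}"
  proof (rule ccontr)
    assume "\<not> ?thesis"
    then obtain x where x: "x \<in> closed_nbhd G (verts C)" "x \<in> diadem G" by auto
    then have "x \<notin> verts C" using no_cycle_vertex by (auto simp: closed_nbhd_def)
    then obtain u where u: "u \<in> verts C" "x \<rightarrow>\<^bsub>G\<^esub> u" using x(1) by (auto simp: closed_nbhd_def nbhd_def)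
    then have "u \<in> closed_nbhd G (diadem G)"
      using dominates_sym[OF u(2)] x(2) CV by (auto simp: closed_nbhd_def nbhd_def)
    then show False using u(1) no_cycle_vertex by auto
  qed
  with no_cycle_vertex show ?thesis by blast
qed

end
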